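(* There do not exist coefficients $C_{lmn}\in\mathbb{C}$ ($l,m,n\in\mathbb{Z}$), not all zero, defining a product rule $(\phi\cdot\psi)_n=\sum_{l,m\in\mathbb{Z}}C_{lmn}\phi_l\psi_m$, and coefficients $D_{mn}\in\mathbb{C}$ ($m,n\in\mathbb{Z}$), not all zero and with $\sum_m D_{mn}=0$ for all $n$, defining a difference operator $(D\phi)_n=\sum_{m\in\mathbb{Z}}D_{mn}\phi_m$, that satisfy all three of the following properties: (i) (translation invariance) $C_{lmn}=C(l-n,m-n)$ and $D_{mn}=D(m-n)$ for functions $C:\mathbb{Z}^2\to\mathbb{C}$ and $D:\mathbb{Z}\to\mathbb{C}$; (ii) (locality) $C(k,l)$ and $D(m)$ decay exponentially; (iii) (Leibniz rule) $D(\phi\cdot\psi)=(D\phi)\cdot\psi+\phi\cdot(D\psi)$, i.e. for all $l,m,n\in\mathbb{Z}$, $\sum_k C_{lmk}D_{kn}=\sum_k C_{kmn}D_{lk}+\sum_k C_{lkn}D_{mk}$.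
   Context: The lattice is the infinite one-dimensional lattice $\mathbb{Z}$; a lattice field is a complex-valued function $\phi=(\phi_n)_{n\in\mathbb{Z}}$. Exponential decay means: there are constants $K,r>0$ with $|C(k,l)|\le K e^{-r(|k|+|l|)}$ for all $k,l\in\mathbb{Z}$ and $|D(m)|\le K e^{-r|m|}$ for all $m\in\mathbb{Z}$. (All sums in (iii) then converge absolutely.) Equivalently, the functions $\hat C(v,w)=\sum_{k,l}C(k,l)v^kw^l$ and $\hat D(z)=\sum_m D(m)z^m$ are holomorphic on $\{1-\epsilon<|v|,|w|<1+\epsilon\}$ and $\{1-\epsilon<|z|<1+\epsilon\}$ respectively, for some $0<\epsilon<1$. A product rule is nontrivial if its coefficients are not all zero (equivalently $\hat C\not\equiv 0$). No associativity of the product is assumed. *)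

theory Defs
  imports "HOL-Analysis.Analysis"
begin

text \<open>
  A lattice field is a function of type \<^typ>\<open>int \<Rightarrow> complex\<close>. In the coefficients
  \<open>C l m n\<close> and \<open>D m n\<close> the last index is the output site.
\<close>

type_synonym lattice_field = "int \<Rightarrow> complex"

definition lattice_product ::
    "(int \<Rightarrow> int \<Rightarrow> int \<Rightarrow> complex) \<Rightarrow> lattice_field \<Rightarrow> lattice_field \<Rightarrow> lattice_field" where
  "lattice_product C \<phi> \<psi> n = (\<Sum>\<^sub>\<infinity>(l, m)\<in>UNIV. C l m n * \<phi> l * \<psi> m)"

definition difference_operator :: "(int \<Rightarrow> int \<Rightarrow> complex) \<Rightarrow> lattice_field \<Rightarrow> lattice_field" where
  "difference_operator D \<phi> n = (\<Sum>\<^sub>\<infinity>m\<in>UNIV. D m n * \<phi> m)"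

definition translation_invariant_product ::
    "(int \<Rightarrow> int \<Rightarrow> int \<Rightarrow> complex) \<Rightarrow> (int \<Rightarrow> int \<Rightarrow> complex) \<Rightarrow> bool" where
  "translation_invariant_product C c \<longleftrightarrow> (\<forall>l m n. C l m n = c (l - n) (m - n))"

definition translation_invariant_difference ::
    "(int \<Rightarrow> int \<Rightarrow> complex) \<Rightarrow> (int \<Rightarrow> complex) \<Rightarrow> bool" where
  "translation_invariant_difference D d \<longleftrightarrow> (\<forall>m n. D m n = d (m - n))"

definition exponentially_local :: "(int \<Rightarrow> int \<Rightarrow> complex) \<Rightarrow> (int \<Rightarrow> complex) \<Rightarrow> bool" where
  "exponentially_local c d \<longleftrightarrow>
     (\<exists>K r :: real. K > 0 \<and> r > 0 \<and>
        (\<forall>k l. norm (c k l) \<le> K * exp (- r * (\<bar>real_of_int k\<bar> + \<bar>real_of_int l\<bar>))) \<and>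
        (\<forall>m. norm (d m) \<le> K * exp (- r * \<bar>real_of_int m\<bar>)))"

text \<open>
  The Leibniz rule is stated for the coefficients. Lemma \<open>leibniz_rule_iff_fields\<close> below shows
  that for translation-invariant, exponentially local coefficients it is the operator identity
  \<open>D (\<phi> \<cdot> \<psi>) = D \<phi> \<cdot> \<psi> + \<phi> \<cdot> D \<psi>\<close> on finitely supported fields, and lemma \<open>leibniz_summable\<close>
  that all of its sums converge absolutely, so the value 0 that \<^const>\<open>infsum\<close> assigns to
  divergent sums plays no role.
\<close>

definition leibniz_rule ::
    "(int \<Rightarrow> int \<Rightarrow> int \<Rightarrow> complex) \<Rightarrow> (int \<Rightarrow> int \<Rightarrow> complex) \<Rightarrow> bool" where
  "leibniz_rule C D \<longleftrightarrow>
     (\<forall>l m n. (\<Sum>\<^sub>\<infinity>k\<in>UNIV. C l m k * D k n) =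
              (\<Sum>\<^sub>\<infinity>k\<in>UNIV. C k m n * D l k) + (\<Sum>\<^sub>\<infinity>k\<in>UNIV. C l k n * D m k))"

lemma summable_on_exp_int:
  fixes r :: real
  assumes "r > 0"
  shows "(\<lambda>k::int. exp (- r * \<bar>real_of_int (k - a)\<bar>)) summable_on UNIV"
proof -
  define f where "f = (\<lambda>k::int. exp (- r * \<bar>real_of_int k\<bar>))"
  have pw: "exp (- r * real n) = exp (- r) ^ n" for n
    by (metis exp_of_nat_mult mult.commute)
  have g: "(\<lambda>n::nat. exp (- r * real n)) summable_on UNIV"
    unfolding pw using assms
    by (intro norm_summable_imp_summable_on) (simp add: norm_power summable_geometric)
  have p: "f summable_on range int"
    using g by (subst summable_on_reindex) (auto simp: f_def o_def)
  have q: "f summable_on range (\<lambda>n. - int n)"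
    using g by (subst summable_on_reindex) (auto simp: f_def o_def inj_on_def)
  have U: "(UNIV :: int set) = range int \<union> (range (\<lambda>n. - int n) - range int)"
    by (auto simp: image_iff) (metis int_cases2)
  have "f summable_on UNIV"
    unfolding U
    by (intro summable_on_Un_disjoint p summable_on_subset_banach[OF q]) auto
  moreover have "bij_betw (\<lambda>k::int. k - a) UNIV UNIV"
    by (rule bij_betwI[where g = "\<lambda>k. k + a"]) auto
  ultimately show ?thesis
    using summable_on_reindex_bij_betw[of "\<lambda>k. k - a" UNIV UNIV f] by (simp add: f_def)
qed

lemma leibniz_summable:
  assumes "translation_invariant_product C c" "translation_invariant_difference D d"
    and "exponentially_local c d"
  shows "(\<lambda>k. norm (C l m k * D k n)) summable_on UNIV"
    and "(\<lambda>k. norm (C k m n * D l k)) summable_on UNIV"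
    and "(\<lambda>k. norm (C l k n * D m k)) summable_on UNIV"
proof -
  obtain K r :: real where K: "K > 0" and r: "r > 0"
    and c: "\<And>k l. norm (c k l) \<le> K * exp (- r * (\<bar>real_of_int k\<bar> + \<bar>real_of_int l\<bar>))"
    and d: "\<And>m. norm (d m) \<le> K * exp (- r * \<bar>real_of_int m\<bar>)"
    using assms(3) unfolding exponentially_local_def by blast
  have cK: "norm (c k l) \<le> K" for k l
  proof -
    have "exp (- r * (\<bar>real_of_int k\<bar> + \<bar>real_of_int l\<bar>)) \<le> 1"
      using r by simp
    then have "K * exp (- r * (\<bar>real_of_int k\<bar> + \<bar>real_of_int l\<bar>)) \<le> K * 1"
      using K by (intro mult_left_mono) auto
    with c[of k l] show ?thesis by linarith
  qed
  have b: "norm (c i j * d m) \<le> K * K * exp (- r * \<bar>real_of_int m\<bar>)" for i j m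
    using mult_mono[OF cK[of i j] d[of m]] K by (simp add: norm_mult mult.assoc)
  have S: "(\<lambda>k. K * K * exp (- r * \<bar>real_of_int (k - a)\<bar>)) summable_on UNIV" for a
    by (intro summable_on_cmult_right summable_on_exp_int r)
  have flip: "\<bar>real_of_int (a - k)\<bar> = \<bar>real_of_int (k - a)\<bar>" for a k by simp
  have C: "C l m n = c (l - n) (m - n)" and D: "D m n = d (m - n)" for l m n
    using assms(1,2)
    by (auto simp: translation_invariant_product_def translation_invariant_difference_def)
  show "(\<lambda>k. norm (C l m k * D k n)) summable_on UNIV"
    unfolding C D
    by (rule Infinite_Sum.abs_summable_on_comparison_test'[OF S[of n]]) (rule b)
  show "(\<lambda>k. norm (C k m n * D l k)) summable_on UNIV"
    unfolding C D
    by (rule Infinite_Sum.abs_summable_on_comparison_test'[OF S[of l]]) (subst flip[symmetric], rule b)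
  show "(\<lambda>k. norm (C l k n * D m k)) summable_on UNIV"
    unfolding C D
    by (rule Infinite_Sum.abs_summable_on_comparison_test'[OF S[of m]]) (subst flip[symmetric], rule b)
qed

lemma has_sum_finite_sum:
  fixes f :: "'a \<Rightarrow> 'b \<Rightarrow> complex"
  assumes "\<And>i. i \<in> I \<Longrightarrow> (f i has_sum s i) A"
  shows "((\<lambda>x. \<Sum>i\<in>I. f i x) has_sum (\<Sum>i\<in>I. s i)) A"
  using assms by (induction I rule: infinite_finite_induct) (auto intro!: has_sum_add)

lemma difference_operator_finite:
  assumes "finite A" "\<And>l. l \<notin> A \<Longrightarrow> \<phi> l = 0"
  shows "difference_operator D \<phi> n = (\<Sum>l\<in>A. D l n * \<phi> l)"
proof -
  have "difference_operator D \<phi> n = infsum (\<lambda>l. D l n * \<phi> l) A"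
    unfolding difference_operator_def by (rule infsum_cong_neutral) (auto simp: assms)
  then show ?thesis using assms by simp
qed

lemma lattice_product_finite:
  assumes "finite A" "\<And>l. l \<notin> A \<Longrightarrow> \<phi> l = 0" "finite B" "\<And>m. m \<notin> B \<Longrightarrow> \<psi> m = 0"
  shows "lattice_product C \<phi> \<psi> n = (\<Sum>l\<in>A. \<Sum>m\<in>B. C l m n * \<phi> l * \<psi> m)"
proof -
  have "lattice_product C \<phi> \<psi> n = infsum (\<lambda>(l, m). C l m n * \<phi> l * \<psi> m) (A \<times> B)"
    unfolding lattice_product_def by (rule infsum_cong_neutral) (auto, metis assms(2), metis assms(4))
  then show ?thesis using assms by (simp add: sum.cartesian_product)
qed

lemma leibniz_sides:
  assumes TI: "translation_invariant_product C c" "translation_invariant_difference D d"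
    "exponentially_local c d"
    and fin: "finite A" "\<And>l. l \<notin> A \<Longrightarrow> \<phi> l = 0" "finite B" "\<And>m. m \<notin> B \<Longrightarrow> \<psi> m = 0"
  shows "difference_operator D (lattice_product C \<phi> \<psi>) n =
           (\<Sum>l\<in>A. \<Sum>m\<in>B. (\<Sum>\<^sub>\<infinity>k\<in>UNIV. C l m k * D k n) * (\<phi> l * \<psi> m))" (is ?one)
    and "lattice_product C (difference_operator D \<phi>) \<psi> n =
           (\<Sum>l\<in>A. \<Sum>m\<in>B. (\<Sum>\<^sub>\<infinity>k\<in>UNIV. C k m n * D l k) * (\<phi> l * \<psi> m))" (is ?two)
    and "lattice_product C \<phi> (difference_operator D \<psi>) n =
           (\<Sum>l\<in>A. \<Sum>m\<in>B. (\<Sum>\<^sub>\<infinity>k\<in>UNIV. C l k n * D m k) * (\<phi> l * \<psi> m))" (is ?three)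
proof -
  note s = leibniz_summable[OF TI, THEN abs_summable_summable, THEN has_sum_infsum]
  have "((\<lambda>k. \<Sum>l\<in>A. \<Sum>m\<in>B. C l m k * D k n * (\<phi> l * \<psi> m)) has_sum
      (\<Sum>l\<in>A. \<Sum>m\<in>B. (\<Sum>\<^sub>\<infinity>k\<in>UNIV. C l m k * D k n) * (\<phi> l * \<psi> m))) UNIV"
    by (intro has_sum_finite_sum has_sum_cmult_left s(1))
  moreover have "(\<lambda>k. \<Sum>l\<in>A. \<Sum>m\<in>B. C l m k * D k n * (\<phi> l * \<psi> m)) =
      (\<lambda>k. D k n * lattice_product C \<phi> \<psi> k)"
    by (simp add: lattice_product_finite[OF fin] sum_distrib_left algebra_simps)
  ultimately show ?one
    unfolding difference_operator_def by (simp add: infsumI)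
next
  note s = leibniz_summable[OF TI, THEN abs_summable_summable, THEN has_sum_infsum]
  have "((\<lambda>(k, j). if j = m then C k m n * D l k * (\<phi> l * \<psi> m) else 0) has_sum
      (\<Sum>\<^sub>\<infinity>k\<in>UNIV. C k m n * D l k) * (\<phi> l * \<psi> m)) UNIV" for l m
  proof -
    have "((\<lambda>k. C k m n * D l k * (\<phi> l * \<psi> m)) has_sum
      (\<Sum>\<^sub>\<infinity>k\<in>UNIV. C k m n * D l k) * (\<phi> l * \<psi> m)) UNIV"
      by (intro has_sum_cmult_left s(2))
    then have "((\<lambda>(k, j). if j = m then C k m n * D l k * (\<phi> l * \<psi> m) else 0) has_sum
      (\<Sum>\<^sub>\<infinity>k\<in>UNIV. C k m n * D l k) * (\<phi> l * \<psi> m)) (range (\<lambda>k. (k, m)))"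
      by (subst has_sum_reindex) (auto simp: inj_on_def o_def)
    then show ?thesis
      by (rule has_sum_cong_neutral[THEN iffD1, rotated -1]) auto
  qed
  then have "((\<lambda>x. \<Sum>l\<in>A. \<Sum>m\<in>B. (\<lambda>(k, j). if j = m then C k m n * D l k * (\<phi> l * \<psi> m) else 0) x)
     has_sum (\<Sum>l\<in>A. \<Sum>m\<in>B. (\<Sum>\<^sub>\<infinity>k\<in>UNIV. C k m n * D l k) * (\<phi> l * \<psi> m))) UNIV"
    by (intro has_sum_finite_sum)
  moreover have "(\<lambda>x. \<Sum>l\<in>A. \<Sum>m\<in>B.
        (\<lambda>(k, j). if j = m then C k m n * D l k * (\<phi> l * \<psi> m) else 0) x) =
      (\<lambda>(k, j). C k j n * difference_operator D \<phi> k * \<psi> j)"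
    by (auto simp: fun_eq_iff difference_operator_finite[OF fin(1,2)] sum.delta fin
        sum_distrib_left sum_distrib_right algebra_simps intro!: sum.cong)
  ultimately show ?two
    unfolding lattice_product_def by (simp add: infsumI)
next
  note s = leibniz_summable[OF TI, THEN abs_summable_summable, THEN has_sum_infsum]
  have "((\<lambda>(j, k). if j = l then C l k n * D m k * (\<phi> l * \<psi> m) else 0) has_sum
      (\<Sum>\<^sub>\<infinity>k\<in>UNIV. C l k n * D m k) * (\<phi> l * \<psi> m)) UNIV" for l m
  proof -
    have "((\<lambda>k. C l k n * D m k * (\<phi> l * \<psi> m)) has_sum
      (\<Sum>\<^sub>\<infinity>k\<in>UNIV. C l k n * D m k) * (\<phi> l * \<psi> m)) UNIV"
      by (intro has_sum_cmult_left s(3))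
    then have "((\<lambda>(j, k). if j = l then C l k n * D m k * (\<phi> l * \<psi> m) else 0) has_sum
      (\<Sum>\<^sub>\<infinity>k\<in>UNIV. C l k n * D m k) * (\<phi> l * \<psi> m)) (range (\<lambda>k. (l, k)))"
      by (subst has_sum_reindex) (auto simp: inj_on_def o_def)
    then show ?thesis
      by (rule has_sum_cong_neutral[THEN iffD1, rotated -1]) auto
  qed
  then have "((\<lambda>x. \<Sum>m\<in>B. \<Sum>l\<in>A. (\<lambda>(j, k). if j = l then C l k n * D m k * (\<phi> l * \<psi> m) else 0) x)
     has_sum (\<Sum>m\<in>B. \<Sum>l\<in>A. (\<Sum>\<^sub>\<infinity>k\<in>UNIV. C l k n * D m k) * (\<phi> l * \<psi> m))) UNIV"
    by (intro has_sum_finite_sum)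
  moreover have "(\<lambda>x. \<Sum>m\<in>B. \<Sum>l\<in>A.
        (\<lambda>(j, k). if j = l then C l k n * D m k * (\<phi> l * \<psi> m) else 0) x) =
      (\<lambda>(j, k). C j k n * \<phi> j * difference_operator D \<psi> k)"
    by (auto simp: fun_eq_iff difference_operator_finite[OF fin(3,4)] sum.delta fin
        sum_distrib_left sum_distrib_right algebra_simps intro!: sum.cong)
  ultimately have "lattice_product C \<phi> (difference_operator D \<psi>) n =
     (\<Sum>m\<in>B. \<Sum>l\<in>A. (\<Sum>\<^sub>\<infinity>k\<in>UNIV. C l k n * D m k) * (\<phi> l * \<psi> m))"
    unfolding lattice_product_def by (simp add: infsumI)
  then show ?three by (subst sum.swap)
qed

lemma leibniz_rule_iff_fields:
  assumes TI: "translation_invariant_product C c" "translation_invariant_difference D d"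
    "exponentially_local c d"
  shows "leibniz_rule C D \<longleftrightarrow>
    (\<forall>\<phi> \<psi>. finite {l. \<phi> l \<noteq> 0} \<longrightarrow> finite {m. \<psi> m \<noteq> 0} \<longrightarrow>
      (\<forall>n. difference_operator D (lattice_product C \<phi> \<psi>) n =
           lattice_product C (difference_operator D \<phi>) \<psi> n +
           lattice_product C \<phi> (difference_operator D \<psi>) n))"
    (is "_ \<longleftrightarrow> ?F")
proof
  assume L: "leibniz_rule C D"
  show ?F
  proof (intro allI impI)
    fix \<phi> \<psi> :: lattice_field and n
    assume "finite {l. \<phi> l \<noteq> 0}" "finite {m. \<psi> m \<noteq> 0}"
    note sides = leibniz_sides[OF TI this(1) _ this(2), of \<phi> \<psi>, simplified]
    show "difference_operator D (lattice_product C \<phi> \<psi>) n =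
          lattice_product C (difference_operator D \<phi>) \<psi> n +
          lattice_product C \<phi> (difference_operator D \<psi>) n"
      using L unfolding sides leibniz_rule_def
      by (simp add: distrib_right sum.distrib)
  qed
next
  assume F: ?F
  show "leibniz_rule C D"
    unfolding leibniz_rule_def
  proof (intro allI)
    fix l m n
    define \<phi> \<psi> :: lattice_field
      where "\<phi> = (\<lambda>i. if i = l then 1 else 0)" and "\<psi> = (\<lambda>i. if i = m then 1 else 0)"
    have "finite {l. \<phi> l \<noteq> 0}" "finite {m. \<psi> m \<noteq> 0}"
      by (simp_all add: \<phi>_def \<psi>_def)
    with F have "difference_operator D (lattice_product C \<phi> \<psi>) n =
        lattice_product C (difference_operator D \<phi>) \<psi> n +
        lattice_product C \<phi> (difference_operator D \<psi>) n"
      by blast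
    moreover note leibniz_sides[OF TI, of "{l}" \<phi> "{m}" \<psi> n]
    ultimately show "(\<Sum>\<^sub>\<infinity>k\<in>UNIV. C l m k * D k n) =
        (\<Sum>\<^sub>\<infinity>k\<in>UNIV. C k m n * D l k) + (\<Sum>\<^sub>\<infinity>k\<in>UNIV. C l k n * D m k)"
      by (simp add: \<phi>_def \<psi>_def)
  qed
qed

end

theory Submission
  imports Defs "HOL-Complex_Analysis.Conformal_Mappings"
begin

text \<open>
  Let \<open>F x y = \<Sum>k l. c k l exp (\<i>(kx + ly))\<close> and \<open>G x = \<Sum>m. d m exp (\<i>mx)\<close> for real \<open>x\<close>, \<open>y\<close>. The Leibniz rule
  becomes \<open>F x y (G (x + y) - G x - G y) = 0\<close>. Since \<open>c \<noteq> 0\<close>, there is a point \<open>(x0, y0)\<close> with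
  \<open>F x0 y0 \<noteq> 0\<close>, and by continuity \<open>G\<close> is additive near it: for every small \<open>h\<close>, the function
  \<open>y \<mapsto> G (x0 + h + y) - G (x0 + y)\<close> is constant for \<open>y\<close> near \<open>y0\<close>. Exponential decay makes such
  a series holomorphic on a strip around the real axis, so that its coefficients are determined
  by its values on an interval. Hence \<open>d m (exp (\<i>mh) - 1) = 0\<close> for \<open>m \<noteq> 0\<close>; a small \<open>h > 0\<close> gives
  \<open>d m = 0\<close>, and then \<open>d 0 = \<Sum>m. d m = 0\<close>.
\<close>

section \<open>Fourier series with exponentially decaying coefficients\<close>

definition exp_decaying :: "(int \<Rightarrow> complex) \<Rightarrow> bool" where
  "exp_decaying a \<longleftrightarrow> (\<exists>K r :: real. r > 0 \<and> (\<forall>m. norm (a m) \<le> K * exp (- r * \<bar>real_of_int m\<bar>)))"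

definition symbol :: "(int \<Rightarrow> complex) \<Rightarrow> real \<Rightarrow> complex" where
  "symbol a x = (\<Sum>\<^sub>\<infinity>m\<in>UNIV. a m * cis (of_int m * x))"

lemma exp_decaying_abs_summable:
  assumes "exp_decaying a"
  shows "(\<lambda>m. norm (a m)) summable_on UNIV"
proof -
  obtain K r :: real where r: "r > 0" and a: "\<And>m. norm (a m) \<le> K * exp (- r * \<bar>real_of_int m\<bar>)"
    using assms unfolding exp_decaying_def by blast
  have "(\<lambda>m. K * exp (- r * \<bar>real_of_int m\<bar>)) summable_on UNIV"
    using summable_on_cmult_right[OF summable_on_exp_int[OF r, of 0], of K] by simp
  then show ?thesis
    by (rule Infinite_Sum.abs_summable_on_comparison_test') (rule a)
qed

lemma exp_decaying_mult_bounded: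
  assumes "exp_decaying a" "\<And>m. norm (b m) \<le> B"
  shows "exp_decaying (\<lambda>m. a m * b m)"
proof -
  obtain K r :: real where r: "r > 0" and a: "\<And>m. norm (a m) \<le> K * exp (- r * \<bar>real_of_int m\<bar>)"
    using assms unfolding exp_decaying_def by blast
  have "norm (a m * b m) \<le> K * B * exp (- r * \<bar>real_of_int m\<bar>)" for m
    using mult_mono[OF a[of m] assms(2)[of m]] order_trans[OF norm_ge_zero a[of m]]
    by (simp add: norm_mult mult_ac)
  with r show ?thesis unfolding exp_decaying_def by blast
qed

text \<open>A single exceptional coefficient only enlarges the constant in the bound. Changing the
  coefficient at 0 is how a constant is subtracted from a symbol.\<close>

lemma exp_decaying_fun_upd:
  assumes "exp_decaying a"
  shows "exp_decaying (a(j := v))"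
proof -
  obtain K r :: real where r: "r > 0" and a: "\<And>m. norm (a m) \<le> K * exp (- r * \<bar>real_of_int m\<bar>)"
    using assms unfolding exp_decaying_def by blast
  define L where "L = max K (norm v * exp (r * \<bar>real_of_int j\<bar>))"
  have "norm ((a(j := v)) m) \<le> L * exp (- r * \<bar>real_of_int m\<bar>)" for m
  proof (cases "m = j")
    case True
    have "norm v = norm v * exp (r * \<bar>real_of_int j\<bar>) * exp (- r * \<bar>real_of_int j\<bar>)"
      by (simp add: mult_exp_exp)
    also have "\<dots> \<le> L * exp (- r * \<bar>real_of_int j\<bar>)"
      by (intro mult_right_mono) (auto simp: L_def)
    finally show ?thesis using True by simp
  next
    case False
    have "K * exp (- r * \<bar>real_of_int m\<bar>) \<le> L * exp (- r * \<bar>real_of_int m\<bar>)"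
      by (intro mult_right_mono) (auto simp: L_def)
    with a[of m] have "norm (a m) \<le> L * exp (- r * \<bar>real_of_int m\<bar>)" by linarith
    with False show ?thesis by simp
  qed
  with r show ?thesis unfolding exp_decaying_def by blast
qed

lemma has_sum_symbol:
  assumes "(\<lambda>m. norm (a m)) summable_on UNIV"
  shows "((\<lambda>m. a m * cis (of_int m * x)) has_sum symbol a x) UNIV"
  unfolding symbol_def
  by (rule has_sum_infsum, rule abs_summable_summable) (simp add: norm_mult assms)

section \<open>Holomorphic extension of a symbol to an annulus around the unit circle\<close>

lemma fps_conv_radius_exp_decaying:
  fixes P :: "complex fps"
  assumes "\<And>n. norm (fps_nth P n) \<le> K * exp (- r * real n)"
  shows "fps_conv_radius P \<ge> ereal (exp r)"
  unfolding fps_conv_radius_def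
proof (rule conv_radius_geI_ex')
  fix s :: real
  assume s: "0 < s" "ereal s < ereal (exp r)"
  \<comment> \<open>This is the ratio of the dominating geometric series at radius
    \<open>s\<close>.\<close>
  have q: "exp (- r) * s < 1"
    using s by (simp add: exp_minus field_simps)
  show "summable (\<lambda>n. fps_nth P n * of_real s ^ n)"
  proof (rule summable_comparison_test')
    show "summable (\<lambda>n. K * (exp (- r) * s) ^ n)"
      using s q by (intro summable_mult summable_geometric) auto
    fix n
    have "norm (fps_nth P n * of_real s ^ n) \<le> (K * exp (- r * real n)) * s ^ n"
      using s assms[of n] by (auto simp: norm_mult norm_power intro!: mult_right_mono)
    also have "exp (- r * real n) = exp (- r) ^ n"
      by (metis exp_of_nat_mult mult.commute)
    finally show "norm (fps_nth P n * of_real s ^ n) \<le> K * (exp (- r) * s) ^ n"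
      by (simp add: power_mult_distrib mult.assoc)
  qed
qed

lemma has_sum_eval_fps:
  fixes P :: "complex fps"
  assumes "ereal (norm w) < fps_conv_radius P"
  shows "((\<lambda>n. fps_nth P n * w ^ n) has_sum eval_fps P w) UNIV"
proof (rule norm_summable_imp_has_sum)
  show "summable (\<lambda>n. norm (fps_nth P n * w ^ n))"
    using assms unfolding fps_conv_radius_def by (rule abs_summable_in_conv_radius)
  then show "(\<lambda>n. fps_nth P n * w ^ n) sums eval_fps P w"
    unfolding eval_fps_def by (rule summable_sums[OF summable_norm_cancel])
qed

text \<open>With z = \<open>cis x\<close> the symbol is a Laurent series on the unit circle. Its
  powers of z go into \<open>P\<close> and its powers of 1/z into \<open>Q\<close>. Since
  \<open>exp r\<close> > 1, both series converge beyond the circle. The constant term belongs to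
  \<open>P\<close>, so \<open>Q\<close> vanishes at 0.\<close>

lemma symbol_Laurent_decomposition:
  assumes "exp_decaying a"
  obtains r :: real and P Q :: "complex fps" where "r > 0"
    "fps_conv_radius P \<ge> ereal (exp r)" "fps_conv_radius Q \<ge> ereal (exp r)"
    "\<And>n. fps_nth P n = a (int n)" "\<And>n. fps_nth Q n = (if n = 0 then 0 else a (- int n))"
    "\<And>x. symbol a x = eval_fps P (cis x) + eval_fps Q (cis (- x))"
proof -
  obtain K r :: real where r: "r > 0" and a: "\<And>m. norm (a m) \<le> K * exp (- r * \<bar>real_of_int m\<bar>)"
    using assms unfolding exp_decaying_def by blast
  define P where "P = Abs_fps (\<lambda>n. a (int n))"
  define Q where "Q = Abs_fps (\<lambda>n. if n = 0 then 0 else a (- int n))"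
  have P: "fps_conv_radius P \<ge> ereal (exp r)"
    using a[of "int _"] by (intro fps_conv_radius_exp_decaying[where K = K]) (simp add: P_def)
  have "norm (fps_nth Q n) \<le> K * exp (- r * real n)" for n
    using a[of "- int n"] order_trans[OF norm_ge_zero a[of 0]] by (simp add: Q_def)
  then have Q: "fps_conv_radius Q \<ge> ereal (exp r)"
    by (rule fps_conv_radius_exp_decaying)
  have split: "symbol a x = eval_fps P (cis x) + eval_fps Q (cis (- x))" for x
  proof -
    have lt: "ereal (norm (cis y)) < ereal (exp r)" for y
      using r by simp
    have "((\<lambda>n. a (int n) * cis (of_int (int n) * x)) has_sum eval_fps P (cis x)) UNIV"
      using has_sum_eval_fps[OF less_le_trans[OF lt P], of x]
      by (rule has_sum_cong[THEN iffD1, rotated]) (simp add: P_def Complex.DeMoivre)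
    then have p: "((\<lambda>m. a m * cis (of_int m * x)) has_sum eval_fps P (cis x)) (range int)"
      by (subst has_sum_reindex) (auto simp: o_def)
    have "((\<lambda>n. if n = 0 then 0 else a (- int n) * cis (of_int (- int n) * x))
        has_sum eval_fps Q (cis (- x))) UNIV"
      using has_sum_eval_fps[OF less_le_trans[OF lt Q], of "- x"]
      by (rule has_sum_cong[THEN iffD1, rotated]) (simp add: Q_def Complex.DeMoivre)
    \<comment> \<open>The term at n = 0 is zero. Dropping it makes the two index sets disjoint, so
      that index 0 is counted only once.\<close>
    then have "((\<lambda>n. a (- int n) * cis (of_int (- int n) * x)) has_sum eval_fps Q (cis (- x))) {0<..}"
      by (rule has_sum_cong_neutral[THEN iffD1, rotated -1]) auto
    then have q: "((\<lambda>m. a m * cis (of_int m * x)) has_sum eval_fps Q (cis (- x)))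
        ((\<lambda>n. - int n) ` {0<..})"
      by (subst has_sum_reindex) (auto simp: o_def inj_on_def)
    have U: "range int \<union> (\<lambda>n. - int n) ` {0<..} = UNIV"
    proof -
      have "m \<in> range int \<union> (\<lambda>n. - int n) ` {0<..}" for m
        by (cases m rule: int_cases3) auto
      then show ?thesis by blast
    qed
    have "((\<lambda>m. a m * cis (of_int m * x)) has_sum (eval_fps P (cis x) + eval_fps Q (cis (- x))))
        (range int \<union> (\<lambda>n. - int n) ` {0<..})"
      by (rule has_sum_Un_disjoint[OF p q]) auto
    then show ?thesis
      unfolding U symbol_def by (rule infsumI)
  qed
  show ?thesis
    by (rule that[OF r P Q _ _ split]) (simp_all add: P_def Q_def)
qed

text \<open>The unit circle lies strictly inside both discs of convergence, where power series are
  continuous.\<close>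

lemma isCont_symbol:
  assumes "exp_decaying a"
  shows "isCont (symbol a) x"
proof -
  obtain r :: real and P Q :: "complex fps" where r: "r > 0"
    and P: "fps_conv_radius P \<ge> ereal (exp r)" and Q: "fps_conv_radius Q \<ge> ereal (exp r)"
    and eq: "\<And>x. symbol a x = eval_fps P (cis x) + eval_fps Q (cis (- x))"
    using symbol_Laurent_decomposition[OF assms] by metis
  have lt: "ereal 1 < ereal (exp r)" using r by simp
  have "isCont (\<lambda>x. eval_fps P (cis x) + eval_fps Q (cis (- x))) x"
    using less_le_trans[OF lt P] less_le_trans[OF lt Q]
    by (intro continuous_intros isCont_o2[where g = "eval_fps _"] continuous_eval_fps)
       (auto simp: isCont_def intro!: tendsto_intros)
  then show ?thesis unfolding eq[abs_def] .
qed

text \<open>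
  The non-negative and negative parts of the Laurent series agree up to sign on an annulus, so
  they glue to an entire function that vanishes at infinity.
\<close>

lemma symbol_eq_0_imp_coeff_eq_0:
  assumes a: "exp_decaying a" and ev: "eventually (\<lambda>y. symbol a y = 0) (nhds y0)"
  shows "a m = 0"
proof -
  obtain r :: real and P Q :: "complex fps" where r: "r > 0"
    and P: "fps_conv_radius P \<ge> ereal (exp r)" and Q: "fps_conv_radius Q \<ge> ereal (exp r)"
    and Pn: "\<And>n. fps_nth P n = a (int n)"
    and Qn: "\<And>n. fps_nth Q n = (if n = 0 then 0 else a (- int n))"
    and eq: "\<And>x. symbol a x = eval_fps P (cis x) + eval_fps Q (cis (- x))"
    using symbol_Laurent_decomposition[OF a] by metis
  have hol: "eval_fps F holomorphic_on ball 0 (exp r)" if "fps_conv_radius F \<ge> ereal (exp r)" for F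
    using that by (intro holomorphic_on_eval_fps) (auto simp: less_le_trans[OF less_ereal.simps(1)[THEN iffD2]])
  note holP = hol[OF P] and holQ = hol[OF Q]
  define S where "S = {z. \<bar>Im z\<bar> < r}"
  \<comment> \<open>The extension of the symbol to the strip: the exponentials have modulus exp (-Im
    z) and exp (Im z), both below \<open>exp r\<close> when |Im z| < r.\<close>
  define f where "f z = eval_fps P (exp (\<i> * z)) + eval_fps Q (exp (- (\<i> * z)))" for z
  have fr: "f (of_real x) = symbol a x" for x
    by (simp add: f_def eq cis_conv_exp)
  have S_eq: "S = {z. Im z < r} \<inter> {z. Im z > - r}"
    by (auto simp: S_def)
  have holf: "f holomorphic_on S"
    unfolding f_def
    by (intro holomorphic_intros holomorphic_on_compose_gen[OF _ holP, unfolded o_def]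
        holomorphic_on_compose_gen[OF _ holQ, unfolded o_def]) (auto simp: S_def)
  \<comment> \<open>Identity theorem on the connected strip: the real zeros fill a neighbourhood of
    \<open>y0\<close>, so \<open>y0\<close> is a limit point of zeros of \<open>f\<close>.\<close>
  have f0: "f z = 0" if "z \<in> S" for z
  proof (rule analytic_continuation[OF holf])
    show "open S" unfolding S_eq by (intro open_Int open_halfspace_Im_lt open_halfspace_Im_gt)
    show "connected S" unfolding S_eq
      by (intro convex_connected convex_Int convex_halfspace_Im_lt convex_halfspace_Im_gt)
    show "of_real ` {y. symbol a y = 0} \<subseteq> S" using r by (auto simp: S_def)
    show "of_real y0 \<in> S" using r by (auto simp: S_def)
    have "y0 islimpt {y. symbol a y = 0}"
      using ev by (intro frequently_at_imp_islimpt eventually_frequently)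
        (auto simp: eventually_at_filter elim: eventually_mono)
    then show "complex_of_real y0 islimpt of_real ` {y. symbol a y = 0}"
      by (intro islimpt_isCont_image) (auto simp: eventually_at_filter)
  qed (use that in \<open>auto simp: fr\<close>)
  have PQ: "eval_fps P w = - eval_fps Q (inverse w)"
    if "exp (- r) < norm w" "norm w < exp r" for w
  proof -
    have w: "w \<noteq> 0" using that by (auto simp: exp_gt_zero not_less)
    \<comment> \<open>A preimage of \<open>w\<close> under z \<mapsto> exp (iz). Its imaginary part
      is -ln |w|, so the annulus condition on \<open>w\<close> places it in the strip.\<close>
    define z where "z = - \<i> * Ln w"
    have "\<bar>ln (norm w)\<bar> < r"
      using that w exp_less_cancel_iff[of "- r" "ln (norm w)"] exp_less_cancel_iff[of "ln (norm w)" r]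
      by (simp add: abs_less_iff)
    then have "z \<in> S" using w by (simp add: S_def z_def)
    moreover have "exp (\<i> * z) = w" using w by (simp add: z_def)
    ultimately show ?thesis using f0[of z] by (simp add: f_def exp_minus add_eq_0_iff2)
  qed
  \<comment> \<open>The two formulas are holomorphic on |w| < exp r and on |w| > exp (-r). These
    sets cover the plane, and by \<open>PQ\<close> the formulas agree on the overlap.\<close>
  define g where "g w = (if w \<in> ball 0 (exp r) then eval_fps P w else - eval_fps Q (inverse w))" for w
  have U: "ball 0 (exp r) \<union> - cball 0 (exp (- r)) = (UNIV :: complex set)"
  proof -
    have lt: "exp (- r) < exp r" using r by simp
    have "norm w < exp r \<or> exp (- r) < norm w" for w :: complex
      using lt by linarith
    then have "w \<in> ball 0 (exp r) \<union> - cball 0 (exp (- r))" for w :: complex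
      by (simp add: not_le)
    then show ?thesis by blast
  qed
  have iQ: "inverse w \<in> ball 0 (exp r)" if "norm w > exp (- r)" for w :: complex
    using less_imp_inverse_less[OF that] by (simp add: norm_inverse exp_minus)
  have "g holomorphic_on (ball 0 (exp r) \<union> - cball 0 (exp (- r)))"
    unfolding g_def
  proof (intro holomorphic_on_If_Un holP holomorphic_on_minus)
    show "(\<lambda>w. eval_fps Q (inverse w)) holomorphic_on - cball 0 (exp (- r))"
      by (intro holomorphic_on_compose_gen[OF _ holQ, unfolded o_def] holomorphic_intros)
         (use iQ in \<open>auto simp: not_le\<close>)
  qed (use PQ in \<open>auto simp: not_le\<close>)
  then have holg: "g holomorphic_on UNIV" unfolding U .
  have "((\<lambda>w. - eval_fps Q (inverse w)) \<longlongrightarrow> - eval_fps Q 0) at_infinity"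
  proof (intro tendsto_minus isCont_tendsto_compose[where g = "eval_fps Q"] tendsto_inverse_0)
    show "isCont (eval_fps Q) 0"
      using holQ by (intro continuous_on_interior[OF holomorphic_on_imp_continuous_on]) auto
  qed
  moreover have "eventually (\<lambda>w. - eval_fps Q (inverse w) = g w) at_infinity"
    unfolding eventually_at_infinity g_def by (rule exI[of _ "exp r"]) auto
  ultimately have "(g \<longlongrightarrow> - eval_fps Q 0) at_infinity"
    by (rule Lim_transform_eventually)
  \<comment> \<open>The limit at infinity is 0 because \<open>Q\<close> has no constant term, so
    Liouville's theorem applies.\<close>
  then have g0: "g w = 0" for w
    using Liouville_weak[OF holg, of 0 w] by (simp add: eval_fps_at_0 Qn)
  have pos: "fps_conv_radius F > 0" if "fps_conv_radius F \<ge> ereal (exp r)" for F :: "complex fps"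
    using that by (rule less_le_trans[rotated]) simp
  have "eventually (\<lambda>w. w \<in> ball 0 (exp r)) (nhds (0::complex))"
    by (intro eventually_nhds_in_open) auto
  then have "eventually (\<lambda>w. eval_fps P w = eval_fps 0 w) (nhds 0)"
  proof eventually_elim
    case (elim w)
    with g0[of w] show ?case by (simp add: g_def)
  qed
  then have P0: "P = 0"
    by (intro eval_fps_eqD pos P) auto
  \<comment> \<open>For 0 < |w| < exp (-r) the inverse of \<open>w\<close> lies outside the ball of
    radius \<open>exp r\<close>, where \<open>g\<close> is given by \<open>Q\<close>. The point w =
    0 is covered by the missing constant term.\<close>
  have "eventually (\<lambda>w. w \<in> ball 0 (exp (- r))) (nhds (0::complex))"
    by (intro eventually_nhds_in_open) auto
  then have "eventually (\<lambda>w. eval_fps Q w = eval_fps 0 w) (nhds 0)"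
  proof eventually_elim
    case (elim w)
    show ?case
    proof (cases "w = 0")
      case True
      then show ?thesis by (simp add: eval_fps_at_0 Qn)
    next
      case False
      then have "inverse w \<notin> ball 0 (exp r)"
        using elim less_imp_inverse_less[of "norm w" "exp (- r)"] by (simp add: norm_inverse exp_minus)
      with g0[of "inverse w"] show ?thesis by (simp add: g_def)
    qed
  qed
  then have Q0: "Q = 0"
    by (intro eval_fps_eqD pos Q) auto
  show ?thesis
  proof (cases m rule: int_cases3)
    case zero
    with Pn[of 0] P0 show ?thesis by simp
  next
    case (pos n)
    with Pn[of n] P0 show ?thesis by simp
  next
    case (neg n)
    with Qn[of n] Q0 show ?thesis by simp
  qed
qed

section \<open>Fourier series in two variables\<close>

definition symbol2 :: "(int \<Rightarrow> int \<Rightarrow> complex) \<Rightarrow> real \<Rightarrow> real \<Rightarrow> complex" where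
  "symbol2 c x y = (\<Sum>\<^sub>\<infinity>(k, l)\<in>UNIV. c k l * cis (of_int k * x + of_int l * y))"

definition exp_decaying2 :: "(int \<Rightarrow> int \<Rightarrow> complex) \<Rightarrow> bool" where
  "exp_decaying2 c \<longleftrightarrow> (\<exists>K r :: real. r > 0 \<and>
     (\<forall>k l. norm (c k l) \<le> K * exp (- r * (\<bar>real_of_int k\<bar> + \<bar>real_of_int l\<bar>))))"

lemma exp_decaying2_swap: "exp_decaying2 c \<Longrightarrow> exp_decaying2 (\<lambda>l k. c k l)"
  unfolding exp_decaying2_def by (subst add.commute) blast

lemma symbol2_swap: "symbol2 c x y = symbol2 (\<lambda>l k. c k l) y x"
proof -
  have "bij_betw prod.swap (UNIV :: (int \<times> int) set) UNIV" by (simp add: bij_swap)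
  from infsum_reindex_bij_betw[OF this,
      of "\<lambda>(k, l). c k l * cis (of_int k * x + of_int l * y)"]
  show ?thesis by (simp add: symbol2_def case_prod_unfold add.commute[of "_ * x"])
qed

lemma exp_decaying2_row:
  assumes "exp_decaying2 c"
  shows "exp_decaying (c k)"
proof -
  obtain K r :: real where r: "r > 0"
    and c: "\<And>k l. norm (c k l) \<le> K * exp (- r * (\<bar>real_of_int k\<bar> + \<bar>real_of_int l\<bar>))"
    using assms unfolding exp_decaying2_def by blast
  have "norm (c k l) \<le> (K * exp (- r * \<bar>real_of_int k\<bar>)) * exp (- r * \<bar>real_of_int l\<bar>)" for l
    using c[of k l] by (simp only: distrib_left exp_add mult.assoc)
  with r show ?thesis unfolding exp_decaying_def by blast
qed

text \<open>The bound is a product of a factor in \<open>k\<close> and a factor in \<open>l\<close>;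
  summing out \<open>l\<close> keeps the decay in \<open>k\<close>. This gives both absolute
  summability over pairs and decay of the partial symbols.\<close>

lemma exp_decaying2_infsum_norm:
  assumes "exp_decaying2 c"
  obtains K r :: real where "r > 0"
    "\<And>k. (\<Sum>\<^sub>\<infinity>l\<in>UNIV. norm (c k l)) \<le> K * exp (- r * \<bar>real_of_int k\<bar>)"
proof -
  obtain K r :: real where r: "r > 0"
    and c: "\<And>k l. norm (c k l) \<le> K * exp (- r * (\<bar>real_of_int k\<bar> + \<bar>real_of_int l\<bar>))"
    using assms unfolding exp_decaying2_def by blast
  define E where "E = (\<Sum>\<^sub>\<infinity>l\<in>UNIV. exp (- r * \<bar>real_of_int l\<bar>))"
  have S: "(\<lambda>l. exp (- r * \<bar>real_of_int l\<bar>)) summable_on UNIV"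
    using summable_on_exp_int[OF r, of 0] by simp
  have "(\<Sum>\<^sub>\<infinity>l\<in>UNIV. norm (c k l)) \<le> K * E * exp (- r * \<bar>real_of_int k\<bar>)" for k
  proof -
    have "(\<Sum>\<^sub>\<infinity>l\<in>UNIV. norm (c k l)) \<le>
        (\<Sum>\<^sub>\<infinity>l\<in>UNIV. (K * exp (- r * \<bar>real_of_int k\<bar>)) * exp (- r * \<bar>real_of_int l\<bar>))"
    proof (rule infsum_mono)
      show "norm (c k l) \<le> (K * exp (- r * \<bar>real_of_int k\<bar>)) * exp (- r * \<bar>real_of_int l\<bar>)" for l
        using c[of k l] by (simp only: distrib_left exp_add mult.assoc)
    qed (intro summable_on_cmult_right S exp_decaying_abs_summable exp_decaying2_row assms)+
    also have "\<dots> = K * exp (- r * \<bar>real_of_int k\<bar>) * E"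
      unfolding E_def by (rule infsum_cmult_right')
    finally show ?thesis by (simp add: mult_ac)
  qed
  with r that show ?thesis by blast
qed

lemma exp_decaying2_abs_summable:
  assumes "exp_decaying2 c"
  shows "(\<lambda>x. norm (case x of (k, l) \<Rightarrow> c k l)) summable_on UNIV"
proof -
  obtain K r :: real where r: "r > 0"
    and K: "\<And>k. (\<Sum>\<^sub>\<infinity>l\<in>UNIV. norm (c k l)) \<le> K * exp (- r * \<bar>real_of_int k\<bar>)"
    using exp_decaying2_infsum_norm[OF assms] by blast
  \<comment> \<open>The row sums are embedded in the complex numbers so that the one-variable
    summability lemma applies to them.\<close>
  have "norm (of_real (\<Sum>\<^sub>\<infinity>l\<in>UNIV. norm (c k l)) :: complex) \<le> K * exp (- r * \<bar>real_of_int k\<bar>)" for k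
  proof -
    have "(\<Sum>\<^sub>\<infinity>l\<in>UNIV. norm (c k l)) \<ge> 0" by (rule infsum_nonneg) (rule norm_ge_zero)
    then show ?thesis unfolding norm_of_real using K[of k] by linarith
  qed
  with r have "exp_decaying (\<lambda>k. of_real (\<Sum>\<^sub>\<infinity>l\<in>UNIV. norm (c k l)))"
    unfolding exp_decaying_def by blast
  from exp_decaying_abs_summable[OF this]
  have "(\<lambda>k. norm (\<Sum>\<^sub>\<infinity>l\<in>UNIV. norm (c k l))) summable_on UNIV"
    unfolding norm_of_real by simp
  then have "(\<lambda>x. norm (case x of (k, l) \<Rightarrow> c k l)) summable_on (UNIV \<times> UNIV)"
    using exp_decaying_abs_summable[OF exp_decaying2_row[OF assms]]
    by (intro Infinite_Sum.abs_summable_on_Sigma_iff[THEN iffD2] conjI ballI) simp_all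
  then show ?thesis by simp
qed

text \<open>For fixed \<open>y\<close> the partial symbols are themselves admissible coefficients in
  \<open>k\<close>, which reduces two-variable questions to one variable.\<close>

lemma exp_decaying_partial_symbol:
  assumes "exp_decaying2 c"
  shows "exp_decaying (\<lambda>k. symbol (c k) y)"
proof -
  obtain K r :: real where r: "r > 0"
    and K: "\<And>k. (\<Sum>\<^sub>\<infinity>l\<in>UNIV. norm (c k l)) \<le> K * exp (- r * \<bar>real_of_int k\<bar>)"
    using exp_decaying2_infsum_norm[OF assms] by blast
  have "norm (symbol (c k) y) \<le> (\<Sum>\<^sub>\<infinity>l\<in>UNIV. norm (c k l))" for k
    unfolding symbol_def
    using norm_infsum_bound[of "\<lambda>l. c k l * cis (of_int l * y)" UNIV]
      exp_decaying_abs_summable[OF exp_decaying2_row[OF assms]]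
    by (simp add: norm_mult)
  with K r show ?thesis unfolding exp_decaying_def by (meson order_trans)
qed

lemma has_sum_symbol2:
  assumes "exp_decaying2 c"
  shows "((\<lambda>(k, l). c k l * cis (of_int k * x + of_int l * y)) has_sum symbol2 c x y) UNIV"
  unfolding symbol2_def
  by (rule has_sum_infsum[OF abs_summable_summable])
    (use exp_decaying2_abs_summable[OF assms] in \<open>simp add: case_prod_unfold norm_mult\<close>)

lemma symbol2_eq_iterated:
  assumes "exp_decaying2 c"
  shows "symbol2 c x y = symbol (\<lambda>k. symbol (c k) y) x"
proof -
  have row: "((\<lambda>l. c k l * cis (of_int k * x + of_int l * y)) has_sum
      symbol (c k) y * cis (of_int k * x)) UNIV" for k
  proof -
    have "((\<lambda>l. c k l * cis (of_int l * y) * cis (of_int k * x)) has_sum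
        symbol (c k) y * cis (of_int k * x)) UNIV"
      by (intro has_sum_cmult_left has_sum_symbol exp_decaying_abs_summable exp_decaying2_row assms)
    then show ?thesis by (simp add: mult.assoc cis_mult add.commute)
  qed
  have "((\<lambda>(k, l). c k l * cis (of_int k * x + of_int l * y)) has_sum symbol2 c x y) (UNIV \<times> UNIV)"
    using has_sum_symbol2[OF assms, of x y] by simp
  then have "((\<lambda>k. symbol (c k) y * cis (of_int k * x)) has_sum symbol2 c x y) UNIV"
    by (rule has_sum_SigmaD) (simp add: row)
  then show ?thesis unfolding symbol_def[of _ x] by (simp add: infsumI)
qed

lemma isCont_symbol2:
  assumes "exp_decaying2 c"
  shows "isCont (\<lambda>x. symbol2 c x y) x" "isCont (\<lambda>y. symbol2 c x y) y"
proof -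
  show "isCont (\<lambda>x. symbol2 c x y) x"
    using isCont_symbol[OF exp_decaying_partial_symbol[OF assms, of y], of x]
    by (simp add: symbol2_eq_iterated[OF assms])
  \<comment> \<open>Continuity in the second variable is continuity in the first for the transposed
    coefficients.\<close>
  note sw = exp_decaying2_swap[OF assms]
  show "isCont (\<lambda>y. symbol2 c x y) y"
    using isCont_symbol[OF exp_decaying_partial_symbol[OF sw, of x], of y]
    by (simp add: symbol2_swap[of c] symbol2_eq_iterated[OF sw])
qed

text \<open>If the symbol vanished identically, uniqueness of coefficients in \<open>x\<close> would
  kill every partial symbol, and uniqueness in \<open>y\<close> would then kill every
  \<open>c k l\<close>. The base point 0 is arbitrary.\<close>

lemma symbol2_nonzero_obtain:
  assumes "exp_decaying2 c" "c k l \<noteq> 0"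
  obtains x y where "symbol2 c x y \<noteq> 0"
proof -
  have "\<exists>x y. symbol2 c x y \<noteq> 0"
  proof (rule ccontr)
    assume "\<not> ?thesis"
    then have 0: "symbol (\<lambda>k. symbol (c k) y) x = 0" for x y
      by (simp add: symbol2_eq_iterated[OF assms(1)])
    have "symbol (c k) y = 0" for y
      by (rule symbol_eq_0_imp_coeff_eq_0[OF exp_decaying_partial_symbol[OF assms(1)], where ?y0.0 = 0])
        (simp add: 0)
    then have "c k l = 0"
      by (intro symbol_eq_0_imp_coeff_eq_0[OF exp_decaying2_row[OF assms(1)], where ?y0.0 = 0]) simp
    with assms(2) show False by simp
  qed
  with that show ?thesis by blast
qed

text \<open>A rearrangement of the absolutely convergent double series for \<open>s * t\<close>: the
  bijection \<open>p\<close> renames pairs, and \<open>k\<close> is summed first. Different choices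
  of \<open>p\<close> yield the three convolutions in the Leibniz rule.\<close>

lemma has_sum_product_reindexed:
  fixes u :: "'a \<Rightarrow> complex" and v :: "'b \<Rightarrow> complex" and p :: "'i \<times> 'k \<Rightarrow> 'a \<times> 'b"
  assumes u: "(\<lambda>i. norm (u i)) summable_on UNIV" "(u has_sum s) UNIV"
    and v: "(\<lambda>i. norm (v i)) summable_on UNIV" "(v has_sum t) UNIV"
    and p: "bij p"
  shows "((\<lambda>i. \<Sum>\<^sub>\<infinity>k\<in>UNIV. u (fst (p (i, k))) * v (snd (p (i, k)))) has_sum s * t) UNIV"
proof -
  have "(\<lambda>x. norm (case x of (a, b) \<Rightarrow> u a * v b)) summable_on (UNIV \<times> UNIV)"
    using u(1) v(1)
    by (intro Infinite_Sum.abs_summable_on_Sigma_iff[THEN iffD2] conjI ballI)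
      (simp_all add: norm_mult infsum_cmult_right' abs_mult infsum_nonneg
        summable_on_cmult_right summable_on_cmult_left)
  then obtain S where S: "((\<lambda>(a, b). u a * v b) has_sum S) (UNIV \<times> UNIV)"
    using abs_summable_summable summable_on_def by blast
  \<comment> \<open>Summing over the second index first identifies the double sum
    \<open>S\<close>.\<close>
  have "((\<lambda>a. u a * t) has_sum S) UNIV"
    by (rule has_sum_SigmaD[OF S]) (auto intro: has_sum_cmult_right v)
  then have "S = s * t"
    using has_sum_cmult_left[OF u(2), of t] has_sum_unique by blast
  with S have "((\<lambda>x. u (fst x) * v (snd x)) has_sum s * t) UNIV"
    by (simp add: case_prod_unfold)
  then have *: "((\<lambda>x. u (fst (p x)) * v (snd (p x))) has_sum s * t) (UNIV \<times> UNIV)"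
    using has_sum_reindex_bij_betw[OF p, of "\<lambda>x. u (fst x) * v (snd x)" "s * t"] by simp
  then have "(\<lambda>(i, k). u (fst (p (i, k))) * v (snd (p (i, k)))) summable_on (UNIV \<times> UNIV)"
    by (intro has_sum_imp_summable[where S = "s * t"]) (simp add: case_prod_unfold)
  from summable_on_SigmaD1[OF this]
  have "((\<lambda>k. u (fst (p (i, k))) * v (snd (p (i, k)))) has_sum
      (\<Sum>\<^sub>\<infinity>k\<in>UNIV. u (fst (p (i, k))) * v (snd (p (i, k))))) UNIV" for i
    by (intro has_sum_infsum) simp
  then show ?thesis by (intro has_sum_SigmaD[OF *]) simp
qed

section \<open>The Leibniz rule for symbols\<close>

text \<open>The rule at output site 0 is multiplied by the character \<open>e (l, m)\<close> and
  summed over \<open>l\<close> and \<open>m\<close>. Each side is then a convolution, so it becomes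
  a product of symbols.\<close>

lemma leibniz_rule_symbol:
  assumes TI: "translation_invariant_product C c" "translation_invariant_difference D d"
    and c: "exp_decaying2 c" and d: "exp_decaying d" and L: "leibniz_rule C D"
  shows "symbol2 c x y * symbol d (x + y) = symbol2 c x y * (symbol d x + symbol d y)"
proof -
  have C: "C l m n = c (l - n) (m - n)" and D: "D m n = d (m - n)" for l m n
    using TI
    by (auto simp: translation_invariant_product_def translation_invariant_difference_def)
  define u where "u = (\<lambda>(k :: int, l :: int). c k l * cis (of_int k * x + of_int l * y))"
  define v where "v z j = d j * cis (of_int j * z)" for z :: real and j :: int
  have u: "(\<lambda>i. norm (u i)) summable_on UNIV" "(u has_sum symbol2 c x y) UNIV"
    using exp_decaying2_abs_summable[OF c] has_sum_symbol2[OF c, of x y]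
    by (simp_all add: u_def case_prod_unfold norm_mult)
  have v: "(\<lambda>i. norm (v z i)) summable_on UNIV" "(v z has_sum symbol d z) UNIV" for z
    using has_sum_symbol[OF exp_decaying_abs_summable[OF d], of z] exp_decaying_abs_summable[OF d]
    by (simp_all add: v_def[abs_def] norm_mult)
  define e where "e = (\<lambda>(l :: int, m :: int). cis (of_int l * x + of_int m * y))"
  have eqI: "(f has_sum s) UNIV" if "(g has_sum s) UNIV" "\<And>l m. g (l, m) = f (l, m)"
    for f g :: "int \<times> int \<Rightarrow> complex" and s
    using that by (metis ext surj_pair)
  \<comment> \<open>The phase splits as lx + my = ((l - k)x + (m - k)y) + k(x + y), so the factor
    \<open>d k\<close> is evaluated at \<open>x + y\<close>.\<close>
  have 1: "((\<lambda>(l, m). (\<Sum>\<^sub>\<infinity>k\<in>UNIV. C l m k * D k 0) * e (l, m)) has_sum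
      symbol2 c x y * symbol d (x + y)) UNIV"
  proof (rule eqI[OF has_sum_product_reindexed[OF u v]])
    show "bij (\<lambda>((l, m), k). ((l - k, m - k), k) :: (int \<times> int) \<times> int)"
      by (rule o_bij[of "\<lambda>((a, b), k). ((a + k, b + k), k)"]) auto
  qed (auto simp: C D u_def v_def e_def infsum_cmult_right'[symmetric] cis_mult algebra_simps
      intro!: infsum_cong)
  \<comment> \<open>Here lx + my = (kx + my) + (l - k)x, so \<open>d\<close> is evaluated at
    \<open>x\<close>. The third sum is the mirror image in \<open>y\<close>.\<close>
  have 2: "((\<lambda>(l, m). (\<Sum>\<^sub>\<infinity>k\<in>UNIV. C k m 0 * D l k) * e (l, m)) has_sum
      symbol2 c x y * symbol d x) UNIV"
  proof (rule eqI[OF has_sum_product_reindexed[OF u v]])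
    show "bij (\<lambda>((l, m), k). ((k, m), l - k) :: (int \<times> int) \<times> int)"
      by (rule o_bij[of "\<lambda>((k, m), j). ((j + k, m), k)"]) auto
  qed (auto simp: C D u_def v_def e_def infsum_cmult_right'[symmetric] cis_mult algebra_simps
      intro!: infsum_cong)
  have 3: "((\<lambda>(l, m). (\<Sum>\<^sub>\<infinity>k\<in>UNIV. C l k 0 * D m k) * e (l, m)) has_sum
      symbol2 c x y * symbol d y) UNIV"
  proof (rule eqI[OF has_sum_product_reindexed[OF u v]])
    show "bij (\<lambda>((l, m), k). ((l, k), m - k) :: (int \<times> int) \<times> int)"
      by (rule o_bij[of "\<lambda>((l, k), j). ((l, j + k), k)"]) auto
  qed (auto simp: C D u_def v_def e_def infsum_cmult_right'[symmetric] cis_mult algebra_simps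
      intro!: infsum_cong)
  have "((\<lambda>(l, m). (\<Sum>\<^sub>\<infinity>k\<in>UNIV. C l m k * D k 0) * e (l, m)) has_sum
      symbol2 c x y * symbol d x + symbol2 c x y * symbol d y) UNIV"
    by (rule eqI[OF has_sum_add[OF 2 3]])
      (use L in \<open>simp add: leibniz_rule_def distrib_right\<close>)
  from has_sum_unique[OF 1 this] show ?thesis by (simp add: distrib_left)
qed

text \<open>Additivity is used only at (x0, y) and (x0 + h, y) for \<open>y\<close> near
  \<open>y0\<close>. Subtracting the two instances cancels \<open>symbol d y\<close> and leaves a
  difference independent of \<open>y\<close>.\<close>

lemma symbol_add_local_imp_coeff_eq_0:
  assumes c: "exp_decaying2 c" and d: "exp_decaying d"
    and add: "\<And>x y. symbol2 c x y \<noteq> 0 \<Longrightarrow> symbol d (x + y) = symbol d x + symbol d y"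
    and nz: "symbol2 c x0 y0 \<noteq> 0" and m: "m \<noteq> 0"
  shows "d m = 0"
proof -
  have "eventually (\<lambda>h. symbol2 c (x0 + h) y0 \<noteq> 0) (at_right 0)"
  proof (rule tendsto_imp_eventually_ne[OF _ nz])
    have "((\<lambda>h. symbol2 c (x0 + h) y0) \<longlongrightarrow> symbol2 c (x0 + 0) y0) (at_right 0)"
      by (intro isCont_tendsto_compose[where g = "\<lambda>x. symbol2 c x y0", OF isCont_symbol2(1)[OF c]]
          tendsto_intros)
    then show "((\<lambda>h. symbol2 c (x0 + h) y0) \<longlongrightarrow> symbol2 c x0 y0) (at_right 0)" by simp
  qed
  \<comment> \<open>This range gives 0 < |mh| < pi, hence cis (mh) \<noteq> 1. The choice of
    \<open>h\<close> depends on \<open>m\<close>.\<close>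
  moreover have "eventually (\<lambda>h. h \<in> {0<..<pi / \<bar>of_int m\<bar>}) (at_right 0)"
    by (intro eventually_at_right_real) (use m in auto)
  ultimately have "eventually (\<lambda>h. symbol2 c (x0 + h) y0 \<noteq> 0 \<and> h \<in> {0<..<pi / \<bar>of_int m\<bar>})
      (at_right (0 :: real))"
    by (rule eventually_conj)
  then have "\<exists>h. symbol2 c (x0 + h) y0 \<noteq> 0 \<and> h \<in> {0<..<pi / \<bar>of_int m\<bar>}"
    by (rule eventually_happens'[rotated]) simp
  then obtain h where hnz: "symbol2 c (x0 + h) y0 \<noteq> 0" and h: "0 < h" "h < pi / \<bar>of_int m\<bar>"
    by auto
  have mh: "cis (of_int m * h) \<noteq> 1"
  proof
    assume "cis (of_int m * h) = 1"
    then have "sin (of_int m * h) = 0" "cos (of_int m * h) = 1"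
      by (simp_all add: complex_eq_iff)
    moreover have "\<bar>of_int m * h\<bar> < pi" "of_int m * h \<noteq> 0"
      using h m by (simp_all add: abs_mult field_simps)
    ultimately show False
      using sin_eq_0_pi[of "of_int m * h"] by (simp add: abs_less_iff)
  qed
  define b where "b j = d j * (cis (of_int j * (x0 + h)) - cis (of_int j * x0))" for j
  define k where "k = symbol d (x0 + h) - symbol d x0"
  \<comment> \<open>Since \<open>b 0\<close> = 0, the update subtracts exactly the constant
    \<open>k\<close> from the symbol of \<open>b\<close> and leaves the coefficient at
    \<open>m\<close> untouched.\<close>
  define a where "a = b(0 := - k)"
  have "exp_decaying b"
    unfolding b_def
    by (rule exp_decaying_mult_bounded[OF d, where B = 2])
      (use norm_triangle_ineq4[of "cis _" "cis _"] in auto)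
  then have ea: "exp_decaying a"
    unfolding a_def by (rule exp_decaying_fun_upd)
  have syma: "symbol a y = symbol d (x0 + h + y) - symbol d (x0 + y) - k" for y
  proof -
    note sd = has_sum_symbol[OF exp_decaying_abs_summable[OF d]]
    have "((\<lambda>j. d j * cis (of_int j * (x0 + h + y)) + - (d j * cis (of_int j * (x0 + y))) +
        (if j = 0 then - k else 0)) has_sum
        symbol d (x0 + h + y) + - symbol d (x0 + y) + - k) UNIV"
      by (intro has_sum_add has_sum_uminusI sd has_sum_finite_neutralI[of "{0}"]) auto
    moreover have "d j * cis (of_int j * (x0 + h + y)) + - (d j * cis (of_int j * (x0 + y))) +
        (if j = 0 then - k else 0) = a j * cis (of_int j * y)" for j
      by (simp add: a_def b_def left_diff_distrib right_diff_distrib mult.assoc cis_mult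
          distrib_left add_ac)
    ultimately show ?thesis unfolding symbol_def[of a] by (simp add: infsumI)
  qed
  have "eventually (\<lambda>y. symbol2 c x y \<noteq> 0) (nhds y0)" if "symbol2 c x y0 \<noteq> 0" for x
    using isCont_symbol2(2)[OF c, where x = x and y = y0] that
    by (intro tendsto_imp_eventually_ne) (auto simp: isCont_def tendsto_nhds_iff)
  from this[OF nz] this[OF hnz] have "eventually (\<lambda>y. symbol a y = 0) (nhds y0)"
    by eventually_elim (simp add: syma k_def add)
  then have "a m = 0"
    by (rule symbol_eq_0_imp_coeff_eq_0[OF ea])
  then have "d m * cis (of_int m * x0) * (cis (of_int m * h) - 1) = 0"
    using m by (simp add: a_def b_def right_diff_distrib distrib_left mult.assoc cis_mult)
  with mh show ?thesis by simp
qed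

theorem mainTheorem2:
  shows "\<not> (\<exists>(C :: int \<Rightarrow> int \<Rightarrow> int \<Rightarrow> complex) (D :: int \<Rightarrow> int \<Rightarrow> complex)
            (c :: int \<Rightarrow> int \<Rightarrow> complex) (d :: int \<Rightarrow> complex).
           (\<exists>l m n. C l m n \<noteq> 0) \<and>
           (\<exists>m n. D m n \<noteq> 0) \<and>
           (\<forall>n. ((\<lambda>m. D m n) has_sum 0) UNIV) \<and>
           translation_invariant_product C c \<and>
           translation_invariant_difference D d \<and>
           exponentially_local c d \<and>
           leibniz_rule C D)"
proof clarify
  fix C D c d l m n i j
  assume C: "C l m n \<noteq> (0 :: complex)" and D: "D i j \<noteq> (0 :: complex)"
    and sum: "\<forall>n. ((\<lambda>m. D m n) has_sum 0) UNIV"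
    and TI: "translation_invariant_product C c" "translation_invariant_difference D d"
    and loc: "exponentially_local c d" and L: "leibniz_rule C D"
  have c: "exp_decaying2 c" and d: "exp_decaying d"
    using loc unfolding exponentially_local_def exp_decaying2_def exp_decaying_def by blast+
  have "c (l - n) (m - n) \<noteq> 0"
    using C TI(1) by (simp add: translation_invariant_product_def)
  then obtain x0 y0 where nz: "symbol2 c x0 y0 \<noteq> 0"
    using symbol2_nonzero_obtain[OF c] by blast
  have add: "symbol d (x + y) = symbol d x + symbol d y" if "symbol2 c x y \<noteq> 0" for x y
    using leibniz_rule_symbol[OF TI c d L, of x y] that by simp
  have d0: "d m = 0" if "m \<noteq> 0" for m
    using symbol_add_local_imp_coeff_eq_0[OF c d add nz that] .
  have Dd: "D m n = d (m - n)" for m n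
    using TI(2) by (simp add: translation_invariant_difference_def)
  \<comment> \<open>The coefficients of \<open>D\<close> with output site 0 are those of
    \<open>d\<close> itself.\<close>
  have "(d has_sum 0) UNIV"
    using sum[rule_format, of 0] by (simp add: Dd)
  moreover have "(d has_sum d 0) UNIV"
    by (rule has_sum_finite_neutralI[of "{0}"]) (auto simp: d0)
  ultimately have "d 0 = 0"
    using has_sum_unique by blast
  with d0 D show False by (metis Dd)
qed

end
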